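(* Let $\Psi:\mathbb{Q}[x]\to\mathbb{Q}$ be the linear form with $\Psi(x^n)=B_n$, where $\frac{t}{e^t-1}=\sum_{n\ge0}B_n\frac{t^n}{n!}$, and let $\mathscr{R}^+_n=\Psi\!\left(\binom{x+2}{2}^n\right)$ for $n\ge0$ (so $\mathscr{R}^+_1=1/3$). Let $(R_n)_{n\ge0}$ be the Racah polynomials with parameters $(\alpha,\beta,\gamma,\delta)=(0,1/2,0,-2)$, and let $\Lambda$ be the unique linear form on $\mathbb{Q}[y]$ with $\Lambda(1)=1$ and $\Lambda(R_n)=0$ for all $n>0$. Then $\Lambda(y^n)=2^n\mathscr{R}^+_{n+1}/\mathscr{R}^+_1$ for all $n\ge 0$, i.e. the numbers $(2^n\mathscr{R}^+_{n+1}/\mathscr{R}^+_1)_{n\ge0}$ are the moments of this family of orthogonal polynomials.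
   Context: For parameters $\alpha,\beta,\gamma,\delta$, the Racah polynomial $R_n$ is the polynomial of degree $n$ in a variable $y$ such that, with $\lambda(x)=x(x+\gamma+\delta+1)$, $$R_n(\lambda(x))=\sum_{k=0}^{n}\frac{(-n)_k(n+\alpha+\beta+1)_k(-x)_k(x+\gamma+\delta+1)_k}{(\alpha+1)_k(\beta+\delta+1)_k(\gamma+1)_k\,k!},$$ where $(a)_k=a(a+1)\cdots(a+k-1)$ is the Pochhammer symbol. The "moments" of the family are $\Lambda(y^n)$, $n\ge 0$. *)

theory Defs
  imports "HOL-Computational_Algebra.Computational_Algebra"
begin

(* t / (e^t - 1) = sum of B_n t^n / n!, so B_1 = - 1/2; the quotient is exact in rat fps
   although the divisor is not a unit, see the next lemma. *)
definition bernoulli :: "nat \<Rightarrow> rat" where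
  "bernoulli n = fact n * fps_nth (fps_X / (fps_exp 1 - 1)) n"

lemma bernoulli_gen_fun:
  "Abs_fps (\<lambda>n. bernoulli n / fact n) * (fps_exp 1 - 1) = fps_X"
proof -
  let ?E = "fps_exp 1 - 1 :: rat fps"
  have n1: "fps_nth ?E 1 \<noteq> 0" by simp
  then have nz: "?E \<noteq> 0" by (metis fps_zero_nth)
  have "subdegree ?E \<le> 1"
    using n1 by (rule subdegree_leI)
  then have "?E dvd fps_X"
    using nz by (simp add: fps_dvd_iff)
  moreover have "Abs_fps (\<lambda>n. bernoulli n / fact n) = fps_X / ?E"
    by (simp add: bernoulli_def fps_eq_iff)
  ultimately show ?thesis
    by (metis dvd_div_mult_self)
qed

definition bernoulli_form :: "rat poly \<Rightarrow> rat" where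
  "bernoulli_form p = (\<Sum>i\<le>degree p. coeff p i * bernoulli i)"

lemma bernoulli_form_bound:
  "degree p \<le> N \<Longrightarrow> bernoulli_form p = (\<Sum>i\<le>N. coeff p i * bernoulli i)"
  unfolding bernoulli_form_def
  by (rule sum.mono_neutral_left) (auto simp: coeff_eq_0)

lemma vector_space_rat_poly: "vector_space (smult :: rat \<Rightarrow> rat poly \<Rightarrow> rat poly)"
  by unfold_locales (auto simp: smult_add_left smult_add_right)

lemma vector_space_rat: "vector_space ((*) :: rat \<Rightarrow> rat \<Rightarrow> rat)"
  by unfold_locales (auto simp: algebra_simps)

lemma linear_form_iff:
  "Vector_Spaces.linear (smult :: rat \<Rightarrow> _) (*) L \<longleftrightarrow>
    (\<forall>p q. L (p + q) = L p + L q) \<and> (\<forall>c p. L (smult c p) = c * L p)"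
  using vector_space_rat_poly vector_space_rat
  by (auto simp: Vector_Spaces.linear_def module_hom_def module_hom_axioms_def
      vector_space_def module_def)

lemma linear_bernoulli_form: "Vector_Spaces.linear smult (*) bernoulli_form"
  unfolding linear_form_iff
proof safe
  fix p q :: "rat poly" and c :: rat
  let ?N = "max (degree p) (degree q)"
  show "bernoulli_form (p + q) = bernoulli_form p + bernoulli_form q"
    by (simp add: bernoulli_form_bound[of _ ?N] degree_add_le sum.distrib algebra_simps)
  show "bernoulli_form (smult c p) = c * bernoulli_form p"
    by (simp add: bernoulli_form_bound[of _ "degree p"] sum_distrib_left algebra_simps)
qed

lemma bernoulli_form_monom: "bernoulli_form (monom 1 n) = bernoulli n"
  by (simp add: bernoulli_form_bound[of _ n] degree_monom_le if_distrib[of "\<lambda>c. c * _"]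
      cong: if_cong)

definition binomial_poly :: "rat poly" where
  "binomial_poly = smult (1/2) ([:2, 1:] * [:1, 1:])"

lemma poly_binomial_poly: "poly binomial_poly x = (x + 2) gchoose 2"
  by (simp add: binomial_poly_def gbinomial_prod_rev numeral_2_eq_2 field_simps)

definition rplus :: "nat \<Rightarrow> rat" where
  "rplus n = bernoulli_form (binomial_poly ^ n)"

definition is_racah_poly ::
  "'a::field_char_0 \<Rightarrow> 'a \<Rightarrow> 'a \<Rightarrow> 'a \<Rightarrow> nat \<Rightarrow> 'a poly \<Rightarrow> bool" where
  "is_racah_poly \<alpha> \<beta> \<gamma> \<delta> n p \<longleftrightarrow>
    degree p = n \<and>
    (\<forall>x. poly p (x * (x + \<gamma> + \<delta> + 1)) =
      (\<Sum>k=0..n. (pochhammer (- of_nat n) k * pochhammer (of_nat n + \<alpha> + \<beta> + 1) k *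
                   pochhammer (- x) k * pochhammer (x + \<gamma> + \<delta> + 1) k) /
                 (pochhammer (\<alpha> + 1) k * pochhammer (\<beta> + \<delta> + 1) k *
                   pochhammer (\<gamma> + 1) k * fact k)))"

(* Well defined for the nondegenerate parameters of lemma ex1_racah_poly below. *)
definition racah_poly ::
  "'a::field_char_0 \<Rightarrow> 'a \<Rightarrow> 'a \<Rightarrow> 'a \<Rightarrow> nat \<Rightarrow> 'a poly" where
  "racah_poly \<alpha> \<beta> \<gamma> \<delta> n = (THE p. is_racah_poly \<alpha> \<beta> \<gamma> \<delta> n p)"

lemma degree_prod_linear:
  fixes a :: "nat \<Rightarrow> 'a::field_char_0"
  shows "degree (\<Prod>i<k. [:a i, -1:]) = k \<and> lead_coeff (\<Prod>i<k. [:a i, -1:]) = (-1) ^ k"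
proof (induction k)
  case (Suc k)
  have "degree (\<Prod>i<Suc k. [:a i, -1:]) = Suc k"
    using Suc by (simp only: prod.lessThan_Suc) (subst degree_mult_eq, auto)
  moreover have "lead_coeff (\<Prod>i<Suc k. [:a i, -1:]) = (-1) ^ Suc k"
    using Suc by (simp only: prod.lessThan_Suc lead_coeff_mult) auto
  ultimately show ?case ..
qed simp

lemma ex1_racah_poly:
  fixes \<alpha> \<beta> \<gamma> \<delta> :: "'a::field_char_0"
  assumes "pochhammer (of_nat n + \<alpha> + \<beta> + 1) n \<noteq> 0" "pochhammer (\<alpha> + 1) n \<noteq> 0"
    "pochhammer (\<beta> + \<delta> + 1) n \<noteq> 0" "pochhammer (\<gamma> + 1) n \<noteq> 0"
  shows "\<exists>!p. is_racah_poly \<alpha> \<beta> \<gamma> \<delta> n p"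
proof -
  define s where "s = \<gamma> + \<delta> + 1"
  define Q where "Q = (\<lambda>k. \<Prod>i<k. [:of_nat i * (of_nat i + s), -1:])"
  define c where "c = (\<lambda>k. pochhammer (- of_nat n) k * pochhammer (of_nat n + \<alpha> + \<beta> + 1) k /
      (pochhammer (\<alpha> + 1) k * pochhammer (\<beta> + \<delta> + 1) k * pochhammer (\<gamma> + 1) k * fact k))"
  define P where "P = (\<Sum>k=0..n. smult (c k) (Q k))"
  have dQ: "degree (Q k) = k" "coeff (Q k) k = (-1) ^ k" for k
    using degree_prod_linear[of "\<lambda>i. of_nat i * (of_nat i + s)" k] by (auto simp: Q_def)
  have pQ: "poly (Q k) (x * (x + s)) = pochhammer (- x) k * pochhammer (x + s) k" for k x
    unfolding Q_def by (induction k) (auto simp: pochhammer_Suc poly_prod algebra_simps)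
  have "pochhammer (- of_nat n :: 'a) n \<noteq> 0"
    by (simp add: pochhammer_same)
  then have cn: "c n \<noteq> 0"
    using assms by (simp add: c_def)
  have "coeff P n = (\<Sum>k=0..n. if k = n then c n * (-1) ^ n else 0)"
    unfolding P_def coeff_sum
    by (rule sum.cong) (auto simp: dQ coeff_eq_0)
  then have "coeff P n \<noteq> 0"
    using cn by simp
  moreover have "degree P \<le> n"
    unfolding P_def by (rule degree_sum_le) (auto intro: order.trans[OF degree_smult_le] simp: dQ)
  ultimately have dP: "degree P = n"
    by (meson le_antisym le_degree)
  have P: "is_racah_poly \<alpha> \<beta> \<gamma> \<delta> n P"
    unfolding is_racah_poly_def
    using dP pQ by (simp add: P_def poly_sum c_def s_def add.assoc mult.assoc)
  show ?thesis
  proof (rule ex1I[of _ P])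
    show "is_racah_poly \<alpha> \<beta> \<gamma> \<delta> n P" by (rule P)
  next
    fix p assume p: "is_racah_poly \<alpha> \<beta> \<gamma> \<delta> n p"
    have "poly (pcompose (p - P) [:0, s, 1:]) x = 0" for x
    proof -
      have "poly p (x * (x + s)) = poly P (x * (x + s))"
        using p P by (simp add: is_racah_poly_def s_def add.assoc)
      then show ?thesis
        by (simp add: poly_pcompose algebra_simps)
    qed
    then have "pcompose (p - P) [:0, s, 1:] = 0"
      using poly_all_0_iff_0 by blast
    then show "p = P"
      by (subst (asm) pcompose_eq_0_iff) auto
  qed
qed

lemma pochhammer_nonzeroI:
  fixes a :: "'a::field_char_0"
  assumes "\<And>k. a \<noteq> - of_nat k"
  shows "pochhammer a n \<noteq> 0"
  using assms by (auto simp: pochhammer_eq_0_iff)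

lemma ex1_racah_poly_special: "\<exists>!p. is_racah_poly (0 :: rat) (1/2) 0 (-2) n p"
proof (rule ex1_racah_poly)
  have *: "(1/2 :: rat) + (- 2) + 1 \<noteq> - of_nat k" for k
  proof
    assume "(1/2 :: rat) + (- 2) + 1 = - of_nat k"
    then have "of_nat (2 * k) = (of_nat 1 :: rat)" by simp
    then have "2 * k = 1" by (rule of_nat_eq_iff[THEN iffD1])
    then show False by presburger
  qed
  show "pochhammer ((1/2 :: rat) + (- 2) + 1) n \<noteq> 0"
    by (rule pochhammer_nonzeroI) (rule *)
  show "pochhammer (of_nat n + 0 + (1/2 :: rat) + 1) n \<noteq> 0"
    by (rule less_imp_neq[symmetric], rule pochhammer_pos) (simp add: add_pos_nonneg)
qed (auto simp: pochhammer_fact[symmetric])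


lemma degree_racah_poly: "degree (racah_poly (0 :: rat) (1/2) 0 (-2) n) = n"
  using theI'[OF ex1_racah_poly_special[of n]]
  by (simp add: racah_poly_def is_racah_poly_def)

definition is_moment_functional :: "(nat \<Rightarrow> rat poly) \<Rightarrow> (rat poly \<Rightarrow> rat) \<Rightarrow> bool" where
  "is_moment_functional P \<Lambda> \<longleftrightarrow>
    Vector_Spaces.linear smult (*) \<Lambda> \<and> \<Lambda> 1 = 1 \<and> (\<forall>n>0. \<Lambda> (P n) = 0)"

end

theory Submission
  imports Defs
begin

text \<open>
  In the shifted variable \<open>x\<close> with \<open>y = (x + 1) (x + 2) = \<lambda>(x + 2)\<close> the claimed functional is
  \<open>p \<mapsto> 3 \<Psi>(binom(x + 2, 2) p((x + 1) (x + 2)))\<close>. The rule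
  \<open>\<Psi>(f(x + 1)) = \<Psi>(f(x)) + f'(0)\<close> gives the beta-type evaluation
  \<open>\<Psi>((x + 1)\<^sub>a (-x)\<^sub>b) = a! b! / (a + b + 1)\<close>, hence the values of the functional on the basis
  \<open>(-x - 2)\<^sub>k (x + 1)\<^sub>k\<close> in which the Racah polynomials are expanded, namely
  \<open>k!\<^sup>2 (-1/2)\<^sub>k / (5/2)\<^sub>k\<close>. The functional therefore maps \<open>R\<^sub>n\<close> to the terminating series
  \<open>F(-n, n + 3/2; 5/2; 1)\<close>, which vanishes for \<open>n > 0\<close> by the Chu--Vandermonde identity.
\<close>

section \<open>Linear forms on polynomials\<close>

lemma linear_form_sum:
  fixes L :: "rat poly \<Rightarrow> rat"
  assumes "Vector_Spaces.linear smult (*) L"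
  shows "L (\<Sum>i\<in>A. f i) = (\<Sum>i\<in>A. L (f i))"
proof -
  have add: "L (p + q) = L p + L q" and scale: "L (smult c p) = c * L p" for p q c
    using assms unfolding linear_form_iff by blast+
  have zero: "L 0 = 0"
    using scale[of 0 0] by simp
  show ?thesis
    by (induction A rule: infinite_finite_induct) (simp_all add: add zero)
qed

text \<open>Subtracting a multiple of \<open>P n\<close> from a polynomial of degree n > 0 lowers
  its degree, so strong induction on the degree applies; constants are settled by the value at
  1.\<close>

lemma linear_form_eqI:
  fixes L M :: "rat poly \<Rightarrow> rat"
  assumes lin: "Vector_Spaces.linear smult (*) L" "Vector_Spaces.linear smult (*) M"
    and one: "L 1 = M 1"
    and eq: "\<And>n. n > 0 \<Longrightarrow> L (P n) = M (P n)"
    and deg: "\<And>n. degree (P n) = n"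
  shows "L = M"
proof
  have addL: "L (p + q) = L p + L q" and scaleL: "L (smult c p) = c * L p" for p q c
    using lin(1) unfolding linear_form_iff by blast+
  have addM: "M (p + q) = M p + M q" and scaleM: "M (smult c p) = c * M p" for p q c
    using lin(2) unfolding linear_form_iff by blast+
  fix p
  show "L p = M p"
  proof (induction "degree p" arbitrary: p rule: less_induct)
    case less
    show ?case
    proof (cases "degree p = 0")
      case True
      then obtain c where "p = [:c:]"
        by (rule degree_eq_zeroE)
      then have "p = smult c 1"
        by simp
      then show ?thesis
        by (simp only: scaleL scaleM one)
    next
      case False
      let ?n = "degree p"
      \<comment> \<open>This scalar makes the leading terms cancel in \<open>q\<close>.\<close>
      define c where "c = lead_coeff p / lead_coeff (P ?n)"
      define q where "q = p - smult c (P ?n)"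
      have "P ?n \<noteq> 0"
        using deg[of ?n] False by auto
      then have "coeff (P ?n) ?n \<noteq> 0"
        using deg[of ?n] leading_coeff_neq_0[of "P ?n"] by simp
      then have "coeff q ?n = 0"
        using deg[of ?n] by (simp add: q_def c_def)
      moreover have "degree q \<le> ?n"
        unfolding q_def using deg[of ?n] by (simp add: degree_diff_le)
      ultimately have "degree q < ?n"
        using False by (metis eq_zero_or_degree_less degree_0 gr0I)
      then have "L q = M q"
        by (rule less)
      then have "L (q + smult c (P ?n)) = M (q + smult c (P ?n))"
        using False by (simp add: addL addM scaleL scaleM eq)
      then show ?thesis
        by (simp add: q_def)
    qed
  qed
qed

section \<open>The Bernoulli form and its shift rule\<close>

lemma bernoulli_form_add: "bernoulli_form (p + q) = bernoulli_form p + bernoulli_form q"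
  using linear_bernoulli_form unfolding linear_form_iff by blast

lemma bernoulli_form_smult: "bernoulli_form (smult c p) = c * bernoulli_form p"
  using linear_bernoulli_form unfolding linear_form_iff by blast

lemma bernoulli_form_diff: "bernoulli_form (p - q) = bernoulli_form p - bernoulli_form q"
  using bernoulli_form_add[of "p - q" q] by simp

lemma bernoulli_form_minus: "bernoulli_form (- p) = - bernoulli_form p"
  using bernoulli_form_diff[of 0 p] by (simp add: bernoulli_form_def)

text \<open>Compare coefficients of t^n in B(t) (e^t - 1) = t and multiply by n!. The term i = n
  drops out because e^t - 1 has no constant term.\<close>

lemma sum_binomial_bernoulli:
  "(\<Sum>i<n. of_nat (n choose i) * bernoulli i) = (if n = 1 then 1 else 0)"
proof -
  have "fps_nth (Abs_fps (\<lambda>n. bernoulli n / fact n) * (fps_exp 1 - 1)) n =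
      (\<Sum>i=0..n. bernoulli i / fact i * (if i = n then 0 else 1 / fact (n - i)))"
    unfolding fps_mult_nth by (intro sum.cong) auto
  also have "\<dots> = (\<Sum>i<n. bernoulli i / fact i * (1 / fact (n - i)))"
    by (rule sum.mono_neutral_cong_right) auto
  finally have "(\<Sum>i<n. bernoulli i / fact i * (1 / fact (n - i))) = (if n = 1 then 1 else 0)"
    by (simp add: bernoulli_gen_fun)
  then have "fact n * (\<Sum>i<n. bernoulli i / fact i * (1 / fact (n - i))) = (if n = 1 then 1 else 0)"
    by simp
  moreover have "fact n * (\<Sum>i<n. bernoulli i / fact i * (1 / fact (n - i))) =
      (\<Sum>i<n. of_nat (n choose i) * bernoulli i)"
    unfolding sum_distrib_left by (intro sum.cong) (auto simp: binomial_fact)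
  ultimately show ?thesis
    by simp
qed

text \<open>By linearity only powers of x matter: expanding (x + 1)^n and applying the recurrence
  leaves B_n, plus 1 exactly when n = 1. The correction is thus p'(0).\<close>

lemma bernoulli_form_shift:
  "bernoulli_form (pcompose p [:1, 1:]) = bernoulli_form p + coeff p 1"
proof -
  have monom: "bernoulli_form ([:1, 1:] ^ n) = bernoulli n + (if n = 1 then 1 else 0)" for n
  proof -
    have "degree ([:1, 1:] ^ n :: rat poly) = n"
      by (rule degree_linear_power)
    then have "bernoulli_form ([:1, 1:] ^ n) = (\<Sum>i\<le>n. of_nat (n choose i) * bernoulli i)"
      by (simp add: bernoulli_form_def coeff_linear_poly_power)
    then show ?thesis
      by (simp add: lessThan_Suc_atMost[symmetric] sum_binomial_bernoulli)
  qed
  have "pcompose p [:1, 1:] = (\<Sum>i\<le>degree p. smult (coeff p i) ([:1, 1:] ^ i))"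
    by (rule poly_ext) (simp add: poly_pcompose poly_sum poly_altdef[of p])
  then have "bernoulli_form (pcompose p [:1, 1:]) =
      (\<Sum>i\<le>degree p. coeff p i * (bernoulli i + (if i = 1 then 1 else 0)))"
    by (simp add: linear_form_sum[OF linear_bernoulli_form] bernoulli_form_smult monom)
  also have "\<dots> = bernoulli_form p + (\<Sum>i\<le>degree p. if i = 1 then coeff p i else 0)"
    by (simp add: bernoulli_form_def algebra_simps sum.distrib if_distrib[of "(*) (coeff p _)"] cong: if_cong)
  \<comment> \<open>For constant p the sum misses index 1, but then \<open>coeff p 1\<close> is 0 as
    well.\<close>
  also have "(\<Sum>i\<le>degree p. if i = 1 then coeff p i else 0) = coeff p 1"
    by (simp add: coeff_eq_0)
  finally show ?thesis .
qed

section \<open>Beta-type evaluations\<close>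

lemma pcompose_pochhammer:
  "pcompose (pochhammer p n) q = pochhammer (pcompose p q) n"
  for p q :: "'a::idom poly"
  by (induction n) (simp_all add: pochhammer_Suc pcompose_mult pcompose_add of_nat_poly pcompose_pCons pcompose_1)

lemma poly_pochhammer: "poly (pochhammer p n) x = pochhammer (poly p x) n"
  for p :: "'a::comm_ring_1 poly"
  by (induction n) (simp_all add: pochhammer_Suc)

text \<open>Apply the shift rule to h = x (x + 1) ... (x + n): here h(x + 1) - h(x) = (n + 1) (x +
  1)_n and h'(0) = n!.\<close>

lemma bernoulli_form_pochhammer:
  "bernoulli_form (pochhammer [:1, 1:] n) = fact n / of_nat (n + 1)"
proof -
  let ?h = "pochhammer [:0, 1:] (Suc n) :: rat poly"
  have X: "[:0, 1:] + 1 = ([:1, 1:] :: rat poly)"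
    by (simp add: one_pCons)
  have h: "?h = [:0, 1:] * pochhammer [:1, 1:] n"
    by (simp only: pochhammer_rec X)
  have "coeff ?h 1 = poly (pochhammer [:1, 1:] n) 0"
    by (simp add: h poly_0_coeff_0)
  then have coeff: "coeff ?h 1 = fact n"
    by (simp add: poly_pochhammer pochhammer_fact)
  have "pcompose ?h [:1, 1:] = pochhammer [:1, 1:] (Suc n)"
    by (simp only: pcompose_pochhammer) (simp add: pcompose_pCons)
  also have "\<dots> = ?h + smult (of_nat (n + 1)) (pochhammer [:1, 1:] n)"
    unfolding h by (simp add: pochhammer_Suc of_nat_poly one_pCons algebra_simps smult_add_left)
  finally have "of_nat (n + 1) * bernoulli_form (pochhammer [:1, 1:] n) = fact n"
    using bernoulli_form_shift[of ?h] coeff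
    by (simp only: bernoulli_form_add bernoulli_form_smult)
  then show ?thesis
    by (simp add: field_simps del: of_nat_Suc)
qed

text \<open>Induction on b, with a arbitrary because the recurrence also raises a.\<close>

lemma bernoulli_form_beta:
  "bernoulli_form (pochhammer [:1, 1:] a * pochhammer [:0, -1:] b) =
    fact a * fact b / of_nat (a + b + 1)"
proof (induction b arbitrary: a)
  case 0
  then show ?case
    using bernoulli_form_pochhammer[of a] by simp
next
  case (Suc b)
  let ?w = "\<lambda>a b. pochhammer [:1, 1:] a * pochhammer [:0, -1:] b :: rat poly"
  \<comment> \<open>The new factor b - x is split as (a + b + 1) - (x + 1 + a).\<close>
  have "?w a (Suc b) = smult (of_nat (a + b + 1)) (?w a b) - ?w (Suc a) b"
    by (simp add: pochhammer_Suc of_nat_poly algebra_simps smult_add_left)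
  then have "bernoulli_form (?w a (Suc b)) =
      of_nat (a + b + 1) * bernoulli_form (?w a b) - bernoulli_form (?w (Suc a) b)"
    by (simp only: bernoulli_form_diff bernoulli_form_smult)
  also have "\<dots> = fact a * fact b - fact (Suc a) * fact b / of_nat (a + b + 2)"
    by (simp only: Suc.IH) (simp del: of_nat_Suc of_nat_add fact_Suc)
  also have "\<dots> = fact a * fact (Suc b) / of_nat (a + Suc b + 1)"
  proof -
    have "(of_nat (a + b + 2) :: rat) \<noteq> 0"
      by (simp only: of_nat_eq_0_iff)
    then have "fact a * fact b - fact (Suc a) * fact b / of_nat (a + b + 2) =
        (of_nat (a + b + 2) - of_nat (Suc a)) * (fact a * fact b) / (of_nat (a + b + 2) :: rat)"
      by (simp only: fact_Suc diff_divide_distrib left_diff_distrib) (simp add: mult_ac)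
    then show ?thesis
      by (simp add: algebra_simps)
  qed
  finally show ?case .
qed

text \<open>For k > 0, replacing x by x - 1 turns the argument into a polynomial \<open>G\<close>
  with a double zero at 0, so the shift rule gives no correction; \<open>G\<close> is then a
  combination of three beta values. For k = 0 the argument is simply (x + 1)_2.\<close>

lemma bernoulli_form_racah_basis:
  "bernoulli_form ([:1, 1:] * [:2, 1:] * (pochhammer [:-2, -1:] k * pochhammer [:1, 1:] k)) =
    - 2 * (fact k)\<^sup>2 / ((2 * of_nat k - 1) * (2 * of_nat k + 1) * (2 * of_nat k + 3))"
proof (cases k)
  case 0
  have "[:1, 1:] * [:2, 1:] = pochhammer [:1, 1:] 1 * pochhammer [:0, -1:] 0 +
      pochhammer [:1, 1:] 2 * pochhammer [:0, -1:] 0 - (pochhammer [:1, 1:] 1 :: rat poly)"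
    by (simp add: numeral_2_eq_2 pochhammer_Suc one_pCons)
  then have "bernoulli_form ([:1, 1:] * [:2, 1:]) = 2 / 3"
    by (simp only: bernoulli_form_add bernoulli_form_diff bernoulli_form_beta
        bernoulli_form_pochhammer) (simp add: numeral_2_eq_2)
  with 0 show ?thesis
    by simp
next
  case (Suc j)
  define w :: "nat \<Rightarrow> rat poly" where "w i = pochhammer [:1, 1:] i * pochhammer [:0, -1:] i" for i
  define z :: "rat poly" where "z = [:0, 1:] * [:1, 1:]"
  define c :: rat where "c = of_nat j"
  \<comment> \<open>The two new factors of \<open>w (Suc i)\<close> multiply to (x + 1 + i) (i - x)
    = i (i + 1) - z.\<close>
  have w_Suc: "z * w i = smult (of_nat i * (of_nat i + 1)) (w i) - w (Suc i)" for i
    by (simp add: w_def z_def pochhammer_Suc of_nat_poly algebra_simps smult_add_left)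
  have w: "bernoulli_form (w i) = (fact i)\<^sup>2 / (2 * of_nat i + 1)" for i
    by (simp add: w_def bernoulli_form_beta power2_eq_square)
  define G where "G = z * (pochhammer [:-1, -1:] k * pochhammer [:0, 1:] k)"
  have "[:-1, -1:] + 1 = ([:0, -1:] :: rat poly)" "[:0, 1:] + 1 = ([:1, 1:] :: rat poly)"
    by (simp_all add: one_pCons)
  then have "G = z * (([:-1, -1:] * pochhammer [:0, -1:] j) * ([:0, 1:] * pochhammer [:1, 1:] j))"
    by (simp only: G_def Suc pochhammer_rec)
  also have "\<dots> = - (z * (z * w j))"
  proof -
    have "[:-1, -1:] = - ([:1, 1:] :: rat poly)"
      by simp
    then show ?thesis
      unfolding z_def w_def by (simp only: mult_minus_left mult_minus_right mult_ac)
  qed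
  finally have G: "G = - (z * (z * w j))" .
  have zzw: "z * (z * w j) = smult (c * (c + 1)) (smult (c * (c + 1)) (w j) - w (Suc j)) -
      (smult ((c + 1) * (c + 2)) (w (Suc j)) - w (Suc (Suc j)))"
    by (simp add: w_Suc right_diff_distrib c_def add_ac)
  have "coeff G 1 = 0"
    by (simp add: G z_def mult.assoc coeff_mult_0 coeff_pCons)
  moreover have "pcompose G [:1, 1:] =
      [:1, 1:] * [:2, 1:] * (pochhammer [:-2, -1:] k * pochhammer [:1, 1:] k)"
    by (simp only: G_def z_def pcompose_mult pcompose_pochhammer)
      (simp only: pcompose_pCons pcompose_0, simp)
  ultimately have "bernoulli_form ([:1, 1:] * [:2, 1:] *
      (pochhammer [:-2, -1:] k * pochhammer [:1, 1:] k)) = bernoulli_form G"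
    using bernoulli_form_shift[of G] by simp
  also have "bernoulli_form G = - (c * (c + 1) * (c * (c + 1) * bernoulli_form (w j) -
      bernoulli_form (w (Suc j))) -
      ((c + 1) * (c + 2) * bernoulli_form (w (Suc j)) - bernoulli_form (w (Suc (Suc j)))))"
    by (simp only: G zzw bernoulli_form_minus bernoulli_form_diff bernoulli_form_smult)
  also have "\<dots> = - (fact k)\<^sup>2 *
      (c\<^sup>2 / (2 * c + 1) - 2 * (c + 1)\<^sup>2 / (2 * c + 3) + (c + 2)\<^sup>2 / (2 * c + 5))"
  proof -
    have fact: "fact k = (c + 1) * fact j" "fact (Suc j) = (c + 1) * fact j"
      "fact (Suc (Suc j)) = (c + 2) * ((c + 1) * fact j)"
      by (simp_all add: c_def Suc algebra_simps)
    have "bernoulli_form (w j) = (fact j)\<^sup>2 / (2 * c + 1)"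
      "bernoulli_form (w (Suc j)) = (fact j)\<^sup>2 * (c + 1)\<^sup>2 / (2 * c + 3)"
      "bernoulli_form (w (Suc (Suc j))) = (fact j)\<^sup>2 * (c + 1)\<^sup>2 * (c + 2)\<^sup>2 / (2 * c + 5)"
      unfolding w fact by (simp_all add: c_def power_mult_distrib mult_ac add_ac)
    \<comment> \<open>With the denominators replaced by arbitrary d, e, g, the identity is linear in
      their inverses and needs no nonvanishing conditions.\<close>
    moreover have "- (c * (c + 1) * (c * (c + 1) * (f\<^sup>2 / d) - f\<^sup>2 * (c + 1)\<^sup>2 / e) -
        ((c + 1) * (c + 2) * (f\<^sup>2 * (c + 1)\<^sup>2 / e) - f\<^sup>2 * (c + 1)\<^sup>2 * (c + 2)\<^sup>2 / g)) =
      - ((c + 1) * f)\<^sup>2 * (c\<^sup>2 / d - 2 * (c + 1)\<^sup>2 / e + (c + 2)\<^sup>2 / g)" for d e f g :: rat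
      unfolding divide_inverse by (simp add: power2_eq_square algebra_simps)
    ultimately show ?thesis
      unfolding fact by (simp only:)
  qed
  \<comment> \<open>This is the second difference of u^2 / (2 u + 1) at c. Up to a polynomial of
    degree 1, which it kills, that function is 1 / (4 (2 u + 1)).\<close>
  also have "c\<^sup>2 / (2 * c + 1) - 2 * (c + 1)\<^sup>2 / (2 * c + 3) + (c + 2)\<^sup>2 / (2 * c + 5) =
      2 / ((2 * c + 1) * (2 * c + 3) * (2 * c + 5))"
  proof -
    have "c \<ge> 0"
      by (simp add: c_def)
    then have "2 * c + 1 \<noteq> 0" "2 * c + 3 \<noteq> 0" "2 * c + 5 \<noteq> 0"
      by linarith+
    then show ?thesis
      by (simp add: divide_simps) algebra
  qed
  also have "- (fact k)\<^sup>2 * (2 / ((2 * c + 1) * (2 * c + 3) * (2 * c + 5))) =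
      - 2 * (fact k)\<^sup>2 / ((2 * of_nat k - 1) * (2 * of_nat k + 1) * (2 * of_nat k + 3))"
  proof -
    have "of_nat k = c + 1"
      by (simp add: c_def Suc)
    then show ?thesis
      by (simp add: algebra_simps)
  qed
  finally show ?thesis .
qed

section \<open>The moment functional and its moments\<close>

text \<open>The substitution is y = (x + 1) (x + 2); the factor 3 is 1 / \<open>rplus 1\<close> and
  normalises the value at 1.\<close>

definition racah_moment_form :: "rat poly \<Rightarrow> rat" where
  "racah_moment_form p = 3 * bernoulli_form (binomial_poly * pcompose p (smult 2 binomial_poly))"

lemma linear_racah_moment_form: "Vector_Spaces.linear smult (*) racah_moment_form"
  unfolding linear_form_iff racah_moment_form_def
  by (simp add: pcompose_add pcompose_smult distrib_left bernoulli_form_add bernoulli_form_smult)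

text \<open>The weight \<open>binomial_poly\<close> contributes one more power, whence the index n +
  1.\<close>

lemma racah_moment_form_monom: "racah_moment_form (monom 1 n) = 3 * 2 ^ n * rplus (n + 1)"
proof -
  have "pcompose (monom 1 n) (smult 2 binomial_poly) = smult (2 ^ n) (binomial_poly ^ n)"
    by (simp add: pcompose_altdef poly_monom map_poly_monom smult_power)
  then show ?thesis
    by (simp add: racah_moment_form_def rplus_def bernoulli_form_smult)
qed

lemma rplus_1: "rplus 1 = 1 / 3"
proof -
  have "bernoulli_form ([:1, 1:] * [:2, 1:]) = 2 / 3"
    using bernoulli_form_racah_basis[of 0] by simp
  then have "bernoulli_form ([:2, 1:] * [:1, 1:]) = 2 / 3"
    by (simp only: mult.commute)
  then show ?thesis
    by (simp only: rplus_def binomial_poly_def power_one_right bernoulli_form_smult)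
qed

section \<open>Vanishing on the Racah polynomials\<close>

text \<open>As 5/2 = -1/2 + 3, the quotient telescopes to a (a + 1) (a + 2) / ((a + k) (a + k + 1)
  (a + k + 2)) with a = -1/2. This recasts the basis values in hypergeometric form.\<close>

lemma pochhammer_quotient:
  "pochhammer (- 1 / 2) k / pochhammer (5 / 2) k =
    - 3 / ((2 * of_nat k - 1) * (2 * of_nat k + 1) * (2 * of_nat k + 3) :: rat)"
proof (induction k)
  case (Suc k)
  define c :: rat where "c = of_nat k"
  have "2 * k \<noteq> 1"
    by presburger
  then have "(of_nat (2 * k) :: rat) \<noteq> of_nat 1"
    by (simp only: of_nat_eq_iff not_False_eq_True)
  then have "2 * c - 1 \<noteq> 0"
    by (simp add: c_def)
  have "c \<ge> 0"
    by (simp add: c_def)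
  then have nz: "2 * c + 1 \<noteq> 0" "2 * c + 3 \<noteq> 0" "2 * c + 5 \<noteq> 0" "5 / 2 + c \<noteq> 0"
    by linarith+
  have "pochhammer (- 1 / 2) (Suc k) / pochhammer (5 / 2) (Suc k) =
      pochhammer (- 1 / 2) k / pochhammer (5 / 2) k * ((- 1 / 2 + c) / (5 / 2 + c))"
    by (simp add: pochhammer_Suc c_def)
  also have "(- 1 / 2 + c) / (5 / 2 + c) = (2 * c - 1) / (2 * c + 5)"
    using nz by (simp add: frac_eq_eq) (simp add: field_simps)
  also have "pochhammer (- 1 / 2) k / pochhammer (5 / 2) k * ((2 * c - 1) / (2 * c + 5)) =
      - 3 / ((2 * c + 1) * (2 * c + 3) * (2 * c + 5))"
    unfolding Suc.IH c_def[symmetric] using \<open>2 * c - 1 \<noteq> 0\<close> nz by (simp add: divide_simps)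
  finally show ?case
    by (simp add: c_def algebra_simps)
qed simp

lemma racah_moment_form_racah_basis:
  "racah_moment_form p = (\<Sum>k=0..n. c k * ((fact k)\<^sup>2 * (pochhammer (- 1 / 2) k / pochhammer (5 / 2) k)))"
  if "pcompose p (smult 2 binomial_poly) =
    (\<Sum>k=0..n. smult (c k) (pochhammer [:-2, -1:] k * pochhammer [:1, 1:] k))"
proof -
  let ?u = "\<lambda>k. [:1, 1:] * [:2, 1:] * (pochhammer [:-2, -1:] k * pochhammer [:1, 1:] k) :: rat poly"
  have binomial_mult: "binomial_poly * smult a u = smult (a / 2) ([:1, 1:] * [:2, 1:] * u)" for a u
    by (simp only: binomial_poly_def mult_smult_left mult_smult_right smult_smult
        mult.commute[of "[:2, 1:]" "[:1, 1:]"] times_divide_eq_left times_divide_eq_right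
        mult_1_left mult_1_right)
  have "binomial_poly * pcompose p (smult 2 binomial_poly) = (\<Sum>k=0..n. smult (c k / 2) (?u k))"
    unfolding that sum_distrib_left by (simp only: binomial_mult)
  then have "racah_moment_form p = (\<Sum>k=0..n. 3 * (c k / 2 * bernoulli_form (?u k)))"
    by (simp only: racah_moment_form_def linear_form_sum[OF linear_bernoulli_form]
        bernoulli_form_smult sum_distrib_left)
  then show ?thesis
    unfolding bernoulli_form_racah_basis pochhammer_quotient by (simp add: mult_ac)
qed

text \<open>The basis values cancel (-1/2)_k and two of the three factors k! in the Racah
  denominators, which leaves a Chu-Vandermonde sum.\<close>

lemma racah_moment_form_racah_poly:
  assumes "n > 0"
  shows "racah_moment_form (racah_poly 0 (1/2) 0 (-2) n) = 0"
proof -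
  let ?R = "racah_poly (0 :: rat) (1/2) 0 (-2) n"
  define c :: "nat \<Rightarrow> rat" where "c k = pochhammer (- of_nat n) k * pochhammer (of_nat n + 3/2) k /
      (fact k * pochhammer (-1/2) k * fact k * fact k)" for k
  have R: "poly ?R (x * (x - 1)) = (\<Sum>k=0..n. c k * (pochhammer (- x) k * pochhammer (x - 1) k))" for x
  proof -
    have "(1 / 2 :: rat) + - 2 + 1 = - 1 / 2" "x + 0 + - 2 + 1 = x - 1"
      "of_nat n + 0 + 1 / 2 + 1 = (of_nat n + 3 / 2 :: rat)" "(0 :: rat) + 1 = 1"
      by simp_all
    moreover have "is_racah_poly 0 (1/2) 0 (-2) n ?R"
      unfolding racah_poly_def by (rule theI'[OF ex1_racah_poly_special])
    ultimately show ?thesis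
      unfolding is_racah_poly_def by (simp only: pochhammer_fact[symmetric] c_def) (simp add: mult_ac)
  qed
  \<comment> \<open>For these parameters \<open>R\<close> evaluates at x (x - 1); putting x + 2 for
    x gives (x + 2) (x + 1), which is twice \<open>binomial_poly\<close>.\<close>
  have "poly (pcompose ?R (smult 2 binomial_poly)) x =
      poly (\<Sum>k=0..n. smult (c k) (pochhammer [:-2, -1:] k * pochhammer [:1, 1:] k)) x" for x
    using R[of "x + 2"]
    by (simp add: poly_pcompose binomial_poly_def poly_sum poly_pochhammer algebra_simps)
  then have "pcompose ?R (smult 2 binomial_poly) =
      (\<Sum>k=0..n. smult (c k) (pochhammer [:-2, -1:] k * pochhammer [:1, 1:] k))"
    by (intro poly_ext) blast
  then have "racah_moment_form ?R =
      (\<Sum>k=0..n. c k * ((fact k)\<^sup>2 * (pochhammer (- 1 / 2) k / pochhammer (5 / 2) k)))"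
    by (rule racah_moment_form_racah_basis)
  also have "\<dots> = (\<Sum>k=0..n. pochhammer (of_nat n + 3/2) k * pochhammer (- of_nat n) k /
      (of_nat (fact k) * pochhammer (5 / 2) k))"
  proof (intro sum.cong refl)
    fix k
    have "- 1 / 2 \<noteq> (- of_nat i :: rat)" for i
    proof
      assume "- 1 / 2 = (- of_nat i :: rat)"
      then have "of_nat (2 * i) = (of_nat 1 :: rat)"
        by simp
      then show False
        by (metis of_nat_eq_iff odd_one dvd_triv_left)
    qed
    then have "pochhammer (- 1 / 2 :: rat) k \<noteq> 0"
      by (rule pochhammer_nonzeroI)
    then show "c k * ((fact k)\<^sup>2 * (pochhammer (- 1 / 2) k / pochhammer (5 / 2) k)) =
        pochhammer (of_nat n + 3/2) k * pochhammer (- of_nat n) k /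
        (of_nat (fact k) * pochhammer (5 / 2) k)"
      by (simp add: c_def power2_eq_square)
  qed
  also have "\<dots> = pochhammer (5 / 2 - (of_nat n + 3/2)) n / pochhammer (5 / 2) n"
  proof (rule Vandermonde_pochhammer)
    show "\<forall>i\<in>{0..<n}. (5 / 2 :: rat) \<noteq> - of_nat i"
    proof
      fix i
      have "(of_nat i :: rat) \<ge> 0"
        by simp
      then show "(5 / 2 :: rat) \<noteq> - of_nat i"
        by linarith
    qed
  qed
  \<comment> \<open>The numerator becomes (1 - n)_n, whose last factor is 0 when n > 0.\<close>
  also have "(5 / 2 - (of_nat n + 3/2) :: rat) = - of_nat (n - 1)"
    using assms by (simp add: of_nat_diff)
  also have "pochhammer (- of_nat (n - 1) :: rat) n = 0"
    using assms by (intro pochhammer_of_nat_eq_0_lemma) simp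
  finally show ?thesis
    by simp
qed

section \<open>Existence, uniqueness and moments\<close>

theorem theorem2p3:
  shows "rplus 1 = 1 / 3 \<and>
    (\<exists>!\<Lambda>. is_moment_functional (racah_poly 0 (1/2) 0 (-2)) \<Lambda>) \<and>
    (\<forall>\<Lambda>. is_moment_functional (racah_poly 0 (1/2) 0 (-2)) \<Lambda> \<longrightarrow>
      (\<forall>n. \<Lambda> (monom 1 n) = 2 ^ n * rplus (n + 1) / rplus 1))"
proof -
  let ?P = "racah_poly (0 :: rat) (1/2) 0 (-2)"
  have one: "racah_moment_form 1 = 1"
    using racah_moment_form_monom[of 0] rplus_1 by simp
  have "is_moment_functional ?P racah_moment_form"
    by (simp add: is_moment_functional_def linear_racah_moment_form one racah_moment_form_racah_poly)
  moreover have unique: "\<Lambda> = racah_moment_form" if "is_moment_functional ?P \<Lambda>" for \<Lambda>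
  proof (rule linear_form_eqI[of _ _ ?P])
    show "Vector_Spaces.linear smult (*) \<Lambda>"
      using that by (simp add: is_moment_functional_def)
    show "\<Lambda> 1 = racah_moment_form 1"
      using that one by (simp add: is_moment_functional_def)
    show "\<Lambda> (?P n) = racah_moment_form (?P n)" if "n > 0" for n
      using \<open>is_moment_functional ?P \<Lambda>\<close> that
      by (simp add: is_moment_functional_def racah_moment_form_racah_poly)
  qed (rule linear_racah_moment_form degree_racah_poly)+
  ultimately have "\<exists>!\<Lambda>. is_moment_functional ?P \<Lambda>"
    by blast
  moreover have "racah_moment_form (monom 1 n) = 2 ^ n * rplus (n + 1) / rplus 1" for n
    unfolding racah_moment_form_monom rplus_1 by simp
  ultimately show ?thesis
    using unique rplus_1 by blast
qed

end
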